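(* Let $V$ be a real vector space endowed with a semi-inner product and let $\mathcal{P}_V=\{\langle\cdot,\cdot\rangle:V\times V\to\mathbb{R}\;;\;\langle\cdot,\cdot\rangle\text{ is a semi-inner product on }V\}$. Then $(\mathcal{P}_V,+,\cdot)$ is a semi-vector space over $\mathbb{R}_0^+$, where $+$ is pointwise addition and $\cdot$ is pointwise multiplication by scalars in $\mathbb{R}_0^+$.
   Context: $\mathbb{R}_0^+=[0,\infty)$. A semi-inner product on a real vector space $V$ is a symmetric bilinear form $\langle\cdot,\cdot\rangle:V\times V\to\mathbb{R}$ with $\langle v,v\rangle\ge 0$ for all $v\in V$ (it need not be definite). A semi-vector space over $\mathbb{R}_0^+$ is a set $S$ with operations $+:S\times S\to S$ and $\cdot:\mathbb{R}_0^+\times S\to S$ such that: (1) $(S,+)$ is an abelian monoid satisfying the cancellation law $u+v=u+w\Rightarrow v=w$; (2) $\alpha(u+v)=\alpha u+\alpha v$; (3) $(\alpha+\beta)v=\alpha v+\beta v$; (4) $(\alpha\beta)v=\alpha(\beta v)$; (5) $1v=v$. *)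

theory Defs
  imports "HOL-Algebra.Group" "HOL-Analysis.Linear_Algebra"
begin

definition semi_inner_product :: "('v::real_vector \<Rightarrow> 'v \<Rightarrow> real) \<Rightarrow> bool" where
  "semi_inner_product B \<longleftrightarrow>
     bilinear B \<and> (\<forall>u v. B u v = B v u) \<and> (\<forall>v. B v v \<ge> 0)"

definition semi_inner_products :: "('v::real_vector \<Rightarrow> 'v \<Rightarrow> real) set" where
  "semi_inner_products = {B. semi_inner_product B}"

definition pointwise_add :: "('v \<Rightarrow> 'v \<Rightarrow> real) \<Rightarrow> ('v \<Rightarrow> 'v \<Rightarrow> real) \<Rightarrow> 'v \<Rightarrow> 'v \<Rightarrow> real" where
  "pointwise_add B C = (\<lambda>u v. B u v + C u v)"

definition pointwise_scale :: "real \<Rightarrow> ('v \<Rightarrow> 'v \<Rightarrow> real) \<Rightarrow> 'v \<Rightarrow> 'v \<Rightarrow> real" where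
  "pointwise_scale \<alpha> B = (\<lambda>u v. \<alpha> * B u v)"

(* Scalars range over the nonnegative reals, so smult is only constrained for \<alpha> \<ge> 0.
   As in the usual definition of a monoid, the neutral element is not part of the data;
   it is unique whenever it exists.  Closure of S under add is part of comm_monoid. *)
definition semi_vector_space ::
  "'a set \<Rightarrow> ('a \<Rightarrow> 'a \<Rightarrow> 'a) \<Rightarrow> (real \<Rightarrow> 'a \<Rightarrow> 'a) \<Rightarrow> bool" where
  "semi_vector_space S add smult \<longleftrightarrow>
     (\<exists>z. Group.comm_monoid \<lparr>carrier = S, monoid.mult = add, one = z\<rparr>) \<and>
     (\<forall>u\<in>S. \<forall>v\<in>S. \<forall>w\<in>S. add u v = add u w \<longrightarrow> v = w) \<and>
     (\<forall>\<alpha>\<ge>0. \<forall>v\<in>S. smult \<alpha> v \<in> S) \<and>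
     (\<forall>\<alpha>\<ge>0. \<forall>u\<in>S. \<forall>v\<in>S. smult \<alpha> (add u v) = add (smult \<alpha> u) (smult \<alpha> v)) \<and>
     (\<forall>\<alpha>\<ge>0. \<forall>\<beta>\<ge>0. \<forall>v\<in>S. smult (\<alpha> + \<beta>) v = add (smult \<alpha> v) (smult \<beta> v)) \<and>
     (\<forall>\<alpha>\<ge>0. \<forall>\<beta>\<ge>0. \<forall>v\<in>S. smult (\<alpha> * \<beta>) v = smult \<alpha> (smult \<beta> v)) \<and>
     (\<forall>v\<in>S. smult 1 v = v)"

end

theory Submission
  imports Defs
begin

text \<open>Inside the real vector space of all functions of two vectors, the semi-inner products
  form a convex cone: the zero form belongs to it, and bilinearity, symmetry and positivity survive
  sums and nonnegative multiples (\<open>semi_inner_product_zero\<close>,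
  \<open>semi_inner_product_add\<close>, \<open>semi_inner_product_scale\<close>). The algebraic
  laws, cancellation included, are then inherited from real arithmetic at each pair of
  arguments.\<close>

lemma bilinear_pointwise_add:
  assumes "bilinear B" "bilinear C"
  shows "bilinear (pointwise_add B C)"
  using assms by (auto simp: bilinear_def pointwise_add_def intro: linear_compose_add)

lemma bilinear_pointwise_scale:
  assumes "bilinear B"
  shows "bilinear (pointwise_scale \<alpha> B)"
  using assms
  by (auto simp: bilinear_def pointwise_scale_def linear_iff algebra_simps)

lemma bilinear_zero: "bilinear (\<lambda>u v. 0)"
  by (simp add: bilinear_def linear_zero)

lemma semi_inner_product_zero: "semi_inner_product (\<lambda>u v. 0)"
  by (simp add: semi_inner_product_def bilinear_zero)

lemma semi_inner_product_add:
  assumes "semi_inner_product B" "semi_inner_product C"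
  shows "semi_inner_product (pointwise_add B C)"
  unfolding semi_inner_product_def
proof (intro conjI allI)
  show "bilinear (pointwise_add B C)"
    using assms by (simp add: semi_inner_product_def bilinear_pointwise_add)
  show "pointwise_add B C u v = pointwise_add B C v u" for u v
    using assms unfolding semi_inner_product_def pointwise_add_def by metis
  show "pointwise_add B C v v \<ge> 0" for v
    using assms by (simp add: semi_inner_product_def pointwise_add_def)
qed

text \<open>The sign of \<open>\<alpha>\<close> matters for positivity:
  \<open>\<alpha> * B v v\<close> must stay nonnegative. This is why the scalars form a half-line
  and the structure is a cone.\<close>

lemma semi_inner_product_scale:
  assumes "semi_inner_product B" "\<alpha> \<ge> 0"
  shows "semi_inner_product (pointwise_scale \<alpha> B)"
  unfolding semi_inner_product_def
proof (intro conjI allI)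
  show "bilinear (pointwise_scale \<alpha> B)"
    using assms by (simp add: semi_inner_product_def bilinear_pointwise_scale)
  show "pointwise_scale \<alpha> B u v = pointwise_scale \<alpha> B v u" for u v
    using assms unfolding semi_inner_product_def pointwise_scale_def by metis
  show "pointwise_scale \<alpha> B v v \<ge> 0" for v
    using assms by (simp add: semi_inner_product_def pointwise_scale_def)
qed

lemma comm_monoid_semi_inner_products:
  "Group.comm_monoid \<lparr>carrier = semi_inner_products, monoid.mult = pointwise_add, one = \<lambda>u v. 0\<rparr>"
  by (rule comm_monoidI)
    \<comment> \<open>The closure goals are settled while \<open>pointwise_add\<close> is still
      folded, so that the closure lemmas match; unfolding it then reduces the remaining laws to
      identities between reals.\<close>
    (simp_all add: semi_inner_products_def semi_inner_product_zero semi_inner_product_add,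
      simp_all add: pointwise_add_def algebra_simps)

text \<open>Cancellation of reals at each pair of arguments; the equivalence serves as a rewrite
  rule.\<close>

lemma pointwise_add_left_cancel: "pointwise_add B C = pointwise_add B D \<longleftrightarrow> C = D"
  by (simp add: pointwise_add_def fun_eq_iff)

theorem theorem3p13:
  fixes ip :: "'v::real_vector \<Rightarrow> 'v \<Rightarrow> real"
  assumes "semi_inner_product ip"
  shows "semi_vector_space (semi_inner_products :: ('v \<Rightarrow> 'v \<Rightarrow> real) set)
           pointwise_add pointwise_scale"
  unfolding semi_vector_space_def
proof (intro conjI)
  show "\<exists>z. Group.comm_monoid
      \<lparr>carrier = semi_inner_products :: ('v \<Rightarrow> 'v \<Rightarrow> real) set, monoid.mult = pointwise_add, one = z\<rparr>"
    using comm_monoid_semi_inner_products by blast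
\<comment> \<open>Cancellation and closure under scaling are handled with the operations folded; the
  scalar laws follow after unfolding.\<close>
qed (auto simp: pointwise_add_left_cancel semi_inner_products_def semi_inner_product_scale,
     auto simp: pointwise_add_def pointwise_scale_def algebra_simps)

end
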